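(* Let $Q=\langle y_1,\ldots ,y_p,x_1,\ldots ,x_n\mid r_1,\ldots ,r_m\rangle$ be a presentation with cyclically reduced relators. Suppose we can assign non-negative weights $\omega(e)\ge 0$ to the edges $e$ in $W=W(Q)$, such that the following conditions hold: (1) If $e$ is an edge of $W$ that connects (for some $i,j\le p$) $y_i^\epsilon$ with $y_j^\delta$ ($\epsilon ,\delta =\pm$), then $\omega(e)\ge 1$; (2) If $e$ is an edge of $W$ and exactly one of its boundary points is $y_i^+$ or $y_i^-$ (for some $i\le p$), then $\omega(e)\ge 1/2$; (3) If $z$ is a reduced cycle in $W$, then $\omega(z)\ge 2$; (4) If $r$ is a relator of $Q$ of length $d(r)$, then $\sum_{c\in r}\omega(c)\le d(r)-2$, where the sum is over the corners $c$ of the 2-cell of $r$ (each corner being an edge of $W$). Then $Q$ is DR directed away from $\{ y_1,\ldots ,y_p\}$.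
   Context: For a finite presentation $Q$, $K(Q)$ is the 2-complex with one vertex, one oriented edge for each generator, and one 2-cell for each relator, attached along the relator word. The Whitehead graph $W(Q)$ is the boundary of a regular neighborhood of the only vertex of $K(Q)$. It is a non-oriented (multi)graph with two vertices $a^+,a^-$ for each generator $a$, where $a^+$ is a point of the oriented edge $a$ close to its beginning and $a^-$ a point close to its ending; its edges are the corners of the 2-cells: each pair of cyclically consecutive letters $a^{\epsilon}b^{\delta}$ of a relator gives an edge joining $a^{-}$ (if $\epsilon=1$) or $a^+$ (if $\epsilon=-1$) to $b^+$ (if $\delta=1$) or $b^-$ (if $\delta=-1$). A relator of length $d$ thus contributes $d$ edges (corners). A cycle in a graph is a closed edge path; it is reduced if it contains no (cyclically) consecutive pair $ee^{-1}$ of an edge and its reverse. For an edge path $z=e_1\cdots e_q$, $\omega(z)=\sum_{i=1}^q\omega(e_i)$. A spherical diagram over $K(Q)$ is a map $f\colon C\to K(Q)$, with $C$ a 2-sphere with cell structure, that maps open cells homeomorphically to open cells; the label of an edge of $C$ is the generator it maps to. A folding edge of $C$ is an edge $e$ such that the two 2-cells of $C$ containing $e$ in their boundary map to the same 2-cell of $K(Q)$ with opposite orientations by folding over $e$ (mirror images across $e$, so $e$ corresponds to the same letter position of the relator in both). For a proper subset $S$ (possibly empty) of the generators, $Q$ is DR directed away from $S$ if every spherical diagram that contains an edge with label not from $S$ also contains a folding edge with label not from $S$. *)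

theory Defs
  imports Complex_Main "HOL-Combinatorics.Orbits" "Graph_Theory.Graph_Theory"
begin

section \<open>Presentations\<close>

text \<open>A letter is a generator with an exponent: \<open>(a, True)\<close> is the generator \<open>a\<close>,
  \<open>(a, False)\<close> its inverse.\<close>

type_synonym 'g letter = "'g \<times> bool"
type_synonym 'g word = "'g letter list"

definition inv_letter :: "'g letter \<Rightarrow> 'g letter" where
  "inv_letter l = (fst l, \<not> snd l)"

record 'g presentation =
  gens :: "'g list"
  rels :: "'g word list"

definition is_presentation :: "'g presentation \<Rightarrow> bool" where
  "is_presentation Q \<longleftrightarrow>
     distinct (gens Q) \<and> (\<forall>r \<in> set (rels Q). fst ` set r \<subseteq> set (gens Q))"

text \<open>No letter is cyclically followed by its inverse.\<close>

definition cyclically_reduced :: "'g word \<Rightarrow> bool" where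
  "cyclically_reduced r \<longleftrightarrow>
     (\<forall>k < length r. r ! (Suc k mod length r) \<noteq> inv_letter (r ! k))"


section \<open>The Whitehead graph\<close>

text \<open>The corner \<open>(j, k)\<close> of the 2-cell of the relator \<open>rels Q ! j\<close> lies between its
  letters in positions \<open>k\<close> and \<open>k + 1\<close> (cyclically). The corners are the edges of the
  Whitehead graph; relators are referred to by index, so that a relator which is listed twice
  contributes its corners twice.\<close>

type_synonym corner = "nat \<times> nat"

definition corners :: "'g presentation \<Rightarrow> corner set" where
  "corners Q = {(j, k). j < length (rels Q) \<and> k < length (rels Q ! j)}"

text \<open>The vertices \<open>a\<^sup>+\<close> and \<open>a\<^sup>-\<close> are \<open>(a, True)\<close> and \<open>(a, False)\<close>. The
  corner between \<open>a\<^sup>\<epsilon>\<close> and \<open>b\<^sup>\<delta>\<close> joins \<open>a\<^sup>-\<^sup>\<epsilon>\<close> to \<open>b\<^sup>\<delta>\<close>: a letter \<open>a\<close>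
  traverses its edge from \<open>a\<^sup>+\<close> to \<open>a\<^sup>-\<close>.\<close>

type_synonym 'g wvertex = "'g \<times> bool"

definition corner_source :: "'g presentation \<Rightarrow> corner \<Rightarrow> 'g wvertex" where
  "corner_source Q c = (case c of (j, k) \<Rightarrow>
     let r = rels Q ! j in (fst (r ! k), \<not> snd (r ! k)))"

definition corner_target :: "'g presentation \<Rightarrow> corner \<Rightarrow> 'g wvertex" where
  "corner_target Q c = (case c of (j, k) \<Rightarrow>
     let r = rels Q ! j in r ! (Suc k mod length r))"

text \<open>The non-oriented multigraph \<open>W(Q)\<close> is represented with two mutually reverse arcs
  \<open>(c, True)\<close> and \<open>(c, False)\<close> for each edge \<open>c\<close>.\<close>

definition whitehead_graph :: "'g presentation \<Rightarrow> ('g wvertex, corner \<times> bool) pre_digraph" where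
  "whitehead_graph Q =
     \<lparr> verts = set (gens Q) \<times> UNIV,
       arcs = corners Q \<times> UNIV,
       tail = (\<lambda>(c, b). if b then corner_source Q c else corner_target Q c),
       head = (\<lambda>(c, b). if b then corner_target Q c else corner_source Q c) \<rparr>"

definition rev_arc :: "corner \<times> bool \<Rightarrow> corner \<times> bool" where
  "rev_arc e = (fst e, \<not> snd e)"

text \<open>The trivial closed path is not a cycle.\<close>

definition reduced_cycle :: "'g presentation \<Rightarrow> (corner \<times> bool) list \<Rightarrow> bool" where
  "reduced_cycle Q z \<longleftrightarrow>
     z \<noteq> [] \<and> (\<exists>u. pre_digraph.awalk (whitehead_graph Q) u z u) \<and>
     (\<forall>i < length z. z ! (Suc i mod length z) \<noteq> rev_arc (z ! i))"

definition path_weight :: "(corner \<Rightarrow> real) \<Rightarrow> (corner \<times> bool) list \<Rightarrow> real" where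
  "path_weight \<omega> z = (\<Sum>e \<leftarrow> z. \<omega> (fst e))"


section \<open>Cell structures on the 2-sphere\<close>

text \<open>A cell structure on an oriented closed surface is given by its set of darts (oriented
  edges), the reversal \<open>dart_rev\<close> of darts, and the permutation \<open>face_next\<close> which sends a
  dart \<open>d\<close> to the next dart along the boundary of the 2-cell to the left of \<open>d\<close>. Each dart
  thus occurs exactly once on the positively oriented boundary of exactly one 2-cell. The 2-cells
  are the orbits of \<open>face_next\<close>, the edges are the orbits of \<open>dart_rev\<close>, and the vertices are
  the orbits of \<open>face_next \<circ> dart_rev\<close>, which sends a dart to the next one with the same
  initial vertex. A connected such surface is a sphere iff its Euler characteristic is 2.

  The only cell structure on the sphere that is not covered is the one without edges.\<close>

record 'd cell_structure =
  darts :: "'d set"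
  dart_rev :: "'d \<Rightarrow> 'd"
  face_next :: "'d \<Rightarrow> 'd"

definition cs_faces :: "'d cell_structure \<Rightarrow> 'd set set" where
  "cs_faces C = orbit (face_next C) ` darts C"

definition cs_edges :: "'d cell_structure \<Rightarrow> 'd set set" where
  "cs_edges C = orbit (dart_rev C) ` darts C"

definition cs_vertices :: "'d cell_structure \<Rightarrow> 'd set set" where
  "cs_vertices C = orbit (face_next C \<circ> dart_rev C) ` darts C"

definition closed_surface :: "'d cell_structure \<Rightarrow> bool" where
  "closed_surface C \<longleftrightarrow>
     finite (darts C) \<and>
     dart_rev C permutes darts C \<and>
     (\<forall>d \<in> darts C. dart_rev C d \<noteq> d \<and> dart_rev C (dart_rev C d) = d) \<and>
     face_next C permutes darts C"

definition cs_connected :: "'d cell_structure \<Rightarrow> bool" where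
  "cs_connected C \<longleftrightarrow>
     (\<forall>d \<in> darts C. \<forall>d' \<in> darts C.
        (d, d') \<in> {(a, b). b = dart_rev C a \<or> b = face_next C a}\<^sup>*)"

definition sphere_structure :: "'d cell_structure \<Rightarrow> bool" where
  "sphere_structure C \<longleftrightarrow>
     closed_surface C \<and> cs_connected C \<and>
     int (card (cs_vertices C)) - int (card (cs_edges C)) + int (card (cs_faces C)) = 2"


section \<open>Spherical diagrams\<close>

text \<open>The side \<open>(j, k, \<epsilon>)\<close> is the letter in position \<open>k\<close> of the boundary of the 2-cell
  of \<open>K(Q)\<close> belonging to \<open>rels Q ! j\<close>, where that boundary is traversed along the relator
  if \<open>\<epsilon>\<close> is \<open>True\<close> and along its inverse otherwise.\<close>

type_synonym side = "nat \<times> nat \<times> bool"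

definition sides :: "'g presentation \<Rightarrow> side set" where
  "sides Q = {(j, k, \<epsilon>). j < length (rels Q) \<and> k < length (rels Q ! j)}"

definition side_letter :: "'g presentation \<Rightarrow> side \<Rightarrow> 'g letter" where
  "side_letter Q s = (case s of (j, k, \<epsilon>) \<Rightarrow>
     if \<epsilon> then rels Q ! j ! k else inv_letter (rels Q ! j ! k))"

definition side_next :: "'g presentation \<Rightarrow> side \<Rightarrow> side" where
  "side_next Q s = (case s of (j, k, \<epsilon>) \<Rightarrow>
     let n = length (rels Q ! j)
     in (j, if \<epsilon> then Suc k mod n else (k + n - 1) mod n, \<epsilon>))"

text \<open>The same side, seen from the 2-cell with the opposite orientation.\<close>

definition side_mirror :: "side \<Rightarrow> side" where
  "side_mirror s = (case s of (j, k, \<epsilon>) \<Rightarrow> (j, k, \<not> \<epsilon>))"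

text \<open>A map \<open>C \<rightarrow> K(Q)\<close> that is a homeomorphism on open cells is given by the side \<open>f d\<close>
  to which each dart \<open>d\<close> is sent as part of the boundary of the 2-cell to its left. Boundaries
  of 2-cells are followed compatibly; the injectivity on each 2-cell says that its boundary goes
  exactly once around the boundary of its image (also if the relator is a proper power). The two
  darts of an edge must be sent to the same edge of \<open>K(Q)\<close>, with opposite directions.\<close>

definition spherical_diagram ::
  "'g presentation \<Rightarrow> 'd cell_structure \<Rightarrow> ('d \<Rightarrow> side) \<Rightarrow> bool" where
  "spherical_diagram Q C f \<longleftrightarrow>
     sphere_structure C \<and>
     (\<forall>d \<in> darts C.
        f d \<in> sides Q \<and>
        f (face_next C d) = side_next Q (f d) \<and>
        side_letter Q (f (dart_rev C d)) = inv_letter (side_letter Q (f d))) \<and>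
     (\<forall>F \<in> cs_faces C. inj_on f F)"

text \<open>The label of the edge of \<open>C\<close> containing the dart \<open>d\<close>.\<close>

definition edge_label :: "'g presentation \<Rightarrow> ('d \<Rightarrow> side) \<Rightarrow> 'd \<Rightarrow> 'g" where
  "edge_label Q f d = fst (side_letter Q (f d))"

definition folding_edge :: "'d cell_structure \<Rightarrow> ('d \<Rightarrow> side) \<Rightarrow> 'd \<Rightarrow> bool" where
  "folding_edge C f d \<longleftrightarrow> f (dart_rev C d) = side_mirror (f d)"

text \<open>Cell structures on the sphere are finite, so it is no restriction to use natural numbers
  as darts. The notion is meant for proper subsets \<open>S\<close> of the generators; it holds vacuously if
  \<open>S\<close> contains all of them.\<close>

definition DR_directed_away :: "'g presentation \<Rightarrow> 'g set \<Rightarrow> bool" where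
  "DR_directed_away Q S \<longleftrightarrow>
     (\<forall>(C :: nat cell_structure) f. spherical_diagram Q C f \<longrightarrow>
        (\<exists>d \<in> darts C. edge_label Q f d \<notin> S) \<longrightarrow>
        (\<exists>d \<in> darts C. edge_label Q f d \<notin> S \<and> folding_edge C f d))"

end

theory Submission
  imports Defs
begin

text \<open>The weights act as angles (in units of \<open>\<pi>\<close>), and the proof is a Gauss--Bonnet
  argument on the sphere. Every 2-cell of a spherical diagram is non-positively curved by the
  condition on the relators; summing the weights of all corners once over the 2-cells and once over
  the vertices, the Euler characteristic \<open>2\<close> forces a positively curved vertex, that is, one
  whose corners have total weight less than \<open>2\<close> (\<open>exists_light_vertex\<close>).

  It remains to see that there is no such vertex if all folding edges have labels in \<open>ys\<close>.
  The corners around a vertex form a closed walk in the Whitehead graph, the link of the vertex.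
  If two or more edge ends at the vertex have labels in \<open>ys\<close>, each of them contributes
  \<open>1/2\<close> to both adjacent corners, which already gives weight \<open>2\<close>
  (\<open>vertex_weight_two_labels_in\<close>). Otherwise the link can be cut open at the only edge end with
  label in \<open>ys\<close>, or anywhere if there is none. Since backtracking in the link means folding
  (\<open>link_backtrack_folding\<close>), the link can then backtrack at most where it was cut open. Such a
  closed walk still contains a reduced cycle and thus has weight at least \<open>2\<close>
  (\<open>closed_walk_weight\<close>, \<open>vertex_weight_fold_at_most_once\<close>).\<close>

section \<open>Sums over the orbits of a permutation\<close>

lemma sum_over_orbits:
  assumes "finite D" and "p permutes D"
  shows "(\<Sum>X \<in> orbit p ` D. sum h X) = sum h D"
proof -
  have "{x \<in> D. orbit p x = X} = X" if "X \<in> orbit p ` D" for X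
  proof -
    from that obtain d where d: "d \<in> D" "X = orbit p d" by auto
    have cyc: "cyclic_on p X"
      using cyclic_on_orbit[OF assms(2,1)] d by simp
    have "X \<subseteq> D" using permutes_orbit_subset[OF assms(2) d(1)] d by simp
    moreover have "x \<in> orbit p x" for x
      using assms by (auto intro!: permutation_self_in_orbit simp: permutation_permutes)
    ultimately show ?thesis
      using orbit_cyclic_eq3[OF cyc] by blast
  qed
  then have "(\<Sum>X \<in> orbit p ` D. sum h X) = (\<Sum>X \<in> orbit p ` D. sum h {x \<in> D. orbit p x = X})"
    by simp
  also have "\<dots> = sum h D"
    using assms(1) by (intro sum.group) auto
  finally show ?thesis .
qed

lemma sum_orbit_shift:
  assumes "finite D" and "p permutes D"
  shows "(\<Sum>x \<in> orbit p d. h (p x)) = sum h (orbit p d)"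
proof -
  have "inj_on p (orbit p d)"
    using permutes_inj[OF assms(2)] by (rule inj_on_subset) simp
  moreover have "p ` orbit p d = orbit p d"
  proof (rule endo_inj_surj)
    show "finite (orbit p d)"
      using assms by (auto intro!: finite_orbit permutation_self_in_orbit simp: permutation_permutes)
  qed (auto intro: orbit.step calculation)
  ultimately show ?thesis
    using sum.reindex[of p "orbit p d" h] by simp
qed

section \<open>Closed walks in the Whitehead graph\<close>

lemma wf_digraph_whitehead_graph:
  assumes "is_presentation Q"
  shows "wf_digraph (whitehead_graph Q)"
proof -
  have "fst (rels Q ! j ! k) \<in> set (gens Q)" if "j < length (rels Q)" "k < length (rels Q ! j)" for j k
    using assms nth_mem[OF that(1)] nth_mem[OF that(2)] unfolding is_presentation_def by blast
  moreover have "Suc k mod length (rels Q ! j) < length (rels Q ! j)" if "k < length (rels Q ! j)" for j k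
    using that by (intro mod_less_divisor) auto
  ultimately have "fst (corner_source Q c) \<in> set (gens Q)" "fst (corner_target Q c) \<in> set (gens Q)"
    if "c \<in> corners Q" for c
    using that by (auto simp: corners_def corner_source_def corner_target_def Let_def)
  then show ?thesis
    by unfold_locales (auto simp: whitehead_graph_def mem_Times_iff)
qed

lemma tail_rev_arc: "tail (whitehead_graph Q) (rev_arc e) = head (whitehead_graph Q) e"
  by (cases e) (simp add: whitehead_graph_def rev_arc_def)

text \<open>The walk may backtrack only at its base point. If it does, removing the first and the last arc
  leaves a shorter closed walk of the same kind, which is non-empty since otherwise the two arcs would
  backtrack at an inner vertex. Repeating this conjugation step ends at a
  reduced cycle, and the removed arcs have non-negative weight.\<close>

lemma closed_walk_weight:
  assumes "is_presentation Q" and nonneg: "\<forall>c \<in> corners Q. \<omega> c \<ge> 0"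
    and cycles: "\<forall>z. reduced_cycle Q z \<longrightarrow> path_weight \<omega> z \<ge> 2"
    and "pre_digraph.awalk (whitehead_graph Q) u z u" and "z \<noteq> []"
    and "\<And>i. Suc i < length z \<Longrightarrow> z ! Suc i \<noteq> rev_arc (z ! i)"
  shows "path_weight \<omega> z \<ge> 2"
  using assms(4-6)
proof (induction "length z" arbitrary: u z rule: less_induct)
  case less
  interpret wf_digraph "whitehead_graph Q"
    using assms(1) by (rule wf_digraph_whitehead_graph)
  show ?case
  proof (cases "hd z = rev_arc (last z)")
    case False
    have "z ! (Suc i mod length z) \<noteq> rev_arc (z ! i)" if "i < length z" for i
    proof (cases "Suc i = length z")
      case True
      then have "i = length z - 1" by simp
      then show ?thesis
        using False less.prems(2) True by (simp add: hd_conv_nth last_conv_nth)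
    next
      case False
      then show ?thesis using that less.prems(3)[of i] by simp
    qed
    then have "reduced_cycle Q z"
      using less.prems unfolding reduced_cycle_def by blast
    then show ?thesis using cycles by blast
  next
    case True
    obtain a z' where z: "z = a # z'" using less.prems(2) by (cases z) auto
    have "z' \<noteq> []"
      using True z by (auto simp: rev_arc_def prod_eq_iff)
    then obtain w b where z': "z' = w @ [b]" by (cases z' rule: rev_exhaust) auto
    have a: "a = rev_arc b" using True z z' by simp
    have "w \<noteq> []"
      using less.prems(3)[of 0] a z z' by (auto simp: rev_arc_def)
    have walk: "a \<in> arcs (whitehead_graph Q)" "b \<in> arcs (whitehead_graph Q)"
      "awalk (head (whitehead_graph Q) a) w (tail (whitehead_graph Q) b)"
      using less.prems(1) by (auto simp: z z' awalk_Cons_iff)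
    moreover have "tail (whitehead_graph Q) b = head (whitehead_graph Q) a"
      using tail_rev_arc[of Q a] a by (simp add: rev_arc_def)
    moreover have "w ! Suc i \<noteq> rev_arc (w ! i)" if "Suc i < length w" for i
      using less.prems(3)[of "Suc i"] that by (simp add: z z' nth_append)
    ultimately have "path_weight \<omega> w \<ge> 2"
      using less.hyps[of w "head (whitehead_graph Q) a"] \<open>w \<noteq> []\<close> by (simp add: z z')
    moreover have "\<omega> (fst a) \<ge> 0" "\<omega> (fst b) \<ge> 0"
      using walk nonneg by (auto simp: whitehead_graph_def mem_Times_iff)
    ultimately show ?thesis by (simp add: path_weight_def z z')
  qed
qed

section \<open>Corners along the boundary of a 2-cell\<close>

text \<open>The corner at the end of the side \<open>s\<close>, as an arc of the Whitehead graph with the direction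
  in which the boundary of the 2-cell passes it. Against the orientation of the relator, the corner
  that follows position \<open>k\<close> is the one between positions \<open>k - 1\<close> and \<open>k\<close>.\<close>

definition side_turn :: "'g presentation \<Rightarrow> side \<Rightarrow> corner \<times> bool" where
  "side_turn Q s = (case s of (j, k, \<epsilon>) \<Rightarrow>
     let n = length (rels Q ! j) in ((j, if \<epsilon> then k else (k + n - 1) mod n), \<epsilon>))"

lemma mod_pred: "k < n \<Longrightarrow> (k + n - Suc 0) mod n = (if k = 0 then n - 1 else k - 1)" for k n :: nat
proof (cases k)
  case (Suc l)
  moreover assume "k < n"
  ultimately have "(k + n - Suc 0) mod n = (l + n) mod n" by simp
  then show ?thesis using Suc \<open>k < n\<close> by simp
qed simp

lemma mod_succ: "k < n \<Longrightarrow> Suc k mod n = (if Suc k = n then 0 else Suc k)" for k n :: nat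
  by simp

lemma
  assumes "s \<in> sides Q"
  shows side_turn_in_arcs: "side_turn Q s \<in> arcs (whitehead_graph Q)"
    and tail_side_turn:
      "tail (whitehead_graph Q) (side_turn Q s) = inv_letter (side_letter Q s)"
    and head_side_turn:
      "head (whitehead_graph Q) (side_turn Q s) = side_letter Q (side_next Q s)"
  using assms
  by (auto simp: side_turn_def whitehead_graph_def sides_def corners_def Let_def corner_source_def
      corner_target_def side_letter_def side_next_def inv_letter_def mod_pred mod_succ split: if_splits)

text \<open>A side is determined by the corner at its end, hence also by the corner at its beginning. If
  two 2-cells meet along an edge and the corners on both sides of an end of this edge agree, the
  2-cells are therefore mirror images across the edge.\<close>

lemma side_turn_backtrack:
  assumes "s \<in> sides Q" "t \<in> sides Q" and "side_turn Q t = rev_arc (side_turn Q s)"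
  shows "t = side_mirror (side_next Q s)"
  using assms
  by (auto simp: side_turn_def sides_def Let_def side_next_def rev_arc_def side_mirror_def
      mod_pred mod_succ split: if_splits prod.splits)

text \<open>Running along the inverse relator subtracts \<open>1\<close> modulo the length \<open>n\<close>; adding
  \<open>n - 1\<close> instead avoids truncated subtraction and treats both orientations alike.\<close>

lemma orbit_side_next:
  assumes "j < length (rels Q)" "k < length (rels Q ! j)"
  shows "orbit (side_next Q) (j, k, \<epsilon>) = (\<lambda>i. (j, i, \<epsilon>)) ` {..<length (rels Q ! j)}"
proof -
  define n where "n = length (rels Q ! j)"
  define q where "q = (if \<epsilon> then 1 else n - 1)"
  have n: "k < n" using assms n_def by simp
  have step: "side_next Q (j, i, \<epsilon>) = (j, (i + q) mod n, \<epsilon>)" for i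
    using n by (simp add: side_next_def n_def[symmetric] q_def Let_def)
  have pow: "(side_next Q ^^ i) (j, k, \<epsilon>) = (j, (k + i * q) mod n, \<epsilon>)" for i
    using n by (induction i) (simp_all add: step mod_simps algebra_simps)
  have "(j, i, \<epsilon>) \<in> orbit (side_next Q) (j, k, \<epsilon>)" if "i < n" for i
  proof -
    \<comment> \<open>The exponent is chosen in the range where it is positive, as \<open>orbit_altdef\<close> requires.\<close>
    define e where "e = (if \<epsilon> then i + n - k else k + n - i)"
    have "e > 0" using that n by (simp add: e_def)
    moreover have "(k + e * q) mod n = i"
    proof (cases \<epsilon>)
      case True
      then show ?thesis using that n by (simp add: e_def q_def)
    next
      case False
      obtain e' m where e': "e = Suc e'" and m: "n = Suc m"
        using \<open>e > 0\<close> n gr0_implies_Suc[of e] gr0_implies_Suc[of n] by auto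
      have "k + e * q = i + e' * n"
        using False that e' m by (simp add: e_def q_def)
      then show ?thesis using that by simp
    qed
    ultimately show ?thesis
      using pow[of e] by (auto simp: orbit_altdef intro!: exI[of _ e])
  qed
  moreover have "orbit (side_next Q) (j, k, \<epsilon>) \<subseteq> (\<lambda>i. (j, i, \<epsilon>)) ` {..<n}"
    using n pow by (auto simp: orbit_altdef)
  ultimately show ?thesis by (auto simp: n_def)
qed

lemma sum_turns_relator:
  fixes \<omega> :: "corner \<Rightarrow> real"
  shows "(\<Sum>k < length (rels Q ! j). \<omega> (fst (side_turn Q (j, k, \<epsilon>)))) = (\<Sum>k < length (rels Q ! j). \<omega> (j, k))"
proof (cases \<epsilon>)
  case True
  then show ?thesis by (simp add: side_turn_def Let_def)
next
  case False
  show ?thesis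
    by (rule sum.reindex_bij_witness[where i = "\<lambda>k. Suc k mod length (rels Q ! j)"
          and j = "\<lambda>k. (k + length (rels Q ! j) - 1) mod length (rels Q ! j)"])
      (auto simp: side_turn_def Let_def False mod_pred mod_succ)
qed

section \<open>Links of vertices in a spherical diagram\<close>

text \<open>The step to the next dart with the same initial vertex, whose orbits are the vertices.\<close>

abbreviation rotation :: "'d cell_structure \<Rightarrow> 'd \<Rightarrow> 'd" where
  "rotation C \<equiv> face_next C \<circ> dart_rev C"

lemma rotation_permutes:
  assumes "closed_surface C"
  shows "rotation C permutes darts C"
  using assms unfolding closed_surface_def by (blast intro: permutes_compose)

context
  fixes Q :: "'g presentation" and C :: "'d cell_structure" and f :: "'d \<Rightarrow> side"
  assumes diagram: "spherical_diagram Q C f"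
begin

lemma surface: "closed_surface C"
  using diagram unfolding spherical_diagram_def sphere_structure_def by simp

lemma finite_darts: "finite (darts C)"
  using surface unfolding closed_surface_def by simp

lemma dart_rev_in: "d \<in> darts C \<Longrightarrow> dart_rev C d \<in> darts C"
  using surface unfolding closed_surface_def by (simp add: permutes_in_image)

lemma side_in: "d \<in> darts C \<Longrightarrow> f d \<in> sides Q"
  using diagram unfolding spherical_diagram_def by simp

lemma side_rotation:
  "d \<in> darts C \<Longrightarrow> f (rotation C d) = side_next Q (f (dart_rev C d))"
  using diagram dart_rev_in unfolding spherical_diagram_def by simp

text \<open>The corner between \<open>d\<close> and \<open>rotation C d\<close>. It lies in the 2-cell to the right of
  \<open>d\<close>, where it follows the reverse of \<open>d\<close>.\<close>

definition link_arc :: "'d \<Rightarrow> corner \<times> bool" where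
  "link_arc d = side_turn Q (f (dart_rev C d))"

lemma link_arc_in: "d \<in> darts C \<Longrightarrow> link_arc d \<in> arcs (whitehead_graph Q)"
  unfolding link_arc_def by (intro side_turn_in_arcs side_in dart_rev_in)

text \<open>A dart meets the link of its initial vertex in the vertex of the Whitehead graph given by its
  letter: \<open>a\<close> begins close to \<open>a\<^sup>+\<close> and \<open>a\<^sup>-\<^sup>1\<close> close to \<open>a\<^sup>-\<close>.\<close>

lemma tail_link_arc:
  assumes "d \<in> darts C"
  shows "tail (whitehead_graph Q) (link_arc d) = side_letter Q (f d)"
proof -
  have "side_letter Q (f (dart_rev C d)) = inv_letter (side_letter Q (f d))"
    using diagram assms unfolding spherical_diagram_def by simp
  then show ?thesis
    using assms by (simp add: link_arc_def tail_side_turn side_in dart_rev_in inv_letter_def)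
qed

lemma head_link_arc:
  assumes "d \<in> darts C"
  shows "head (whitehead_graph Q) (link_arc d) = side_letter Q (f (rotation C d))"
  using assms by (simp only: link_arc_def head_side_turn side_in dart_rev_in side_rotation)

lemma link_backtrack_folding:
  assumes "d \<in> darts C"
    and "link_arc (rotation C d) = rev_arc (link_arc d)"
  shows "folding_edge C f (rotation C d)"
proof -
  let ?e = "rotation C d"
  have "?e \<in> darts C"
    using assms(1) permutes_in_image[OF rotation_permutes[OF surface]] by metis
  then have "f (dart_rev C ?e) = side_mirror (side_next Q (f (dart_rev C d)))"
    using assms by (intro side_turn_backtrack) (auto simp: link_arc_def side_in dart_rev_in)
  then show ?thesis
    using side_rotation[OF assms(1)] unfolding folding_edge_def by simp
qed

definition link_walk :: "'d \<Rightarrow> nat \<Rightarrow> (corner \<times> bool) list" where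
  "link_walk d n = map (\<lambda>i. link_arc ((rotation C ^^ i) d)) [0..<n]"

lemma rotation_funpow_in:
  "d \<in> darts C \<Longrightarrow> (rotation C ^^ i) d \<in> darts C"
  by (induction i) (simp_all only: funpow.simps id_apply comp_apply[of "rotation C"]
      permutes_in_image[OF rotation_permutes[OF surface]])

lemma awalk_link_walk:
  assumes "is_presentation Q" and "d \<in> darts C"
  shows "pre_digraph.awalk (whitehead_graph Q) (side_letter Q (f d)) (link_walk d n)
    (side_letter Q (f ((rotation C ^^ n) d)))"
proof -
  interpret wf_digraph "whitehead_graph Q"
    using assms(1) by (rule wf_digraph_whitehead_graph)
  show ?thesis
  proof (induction n)
    case 0
    have "side_letter Q (f d) \<in> verts (whitehead_graph Q)"
      using tail_link_arc[OF assms(2)] tail_in_verts[OF link_arc_in[OF assms(2)]] by simp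
    then show ?case by (simp add: link_walk_def awalk_Nil_iff)
  next
    case (Suc n)
    let ?e = "(rotation C ^^ n) d"
    have e: "?e \<in> darts C" using assms(2) by (rule rotation_funpow_in)
    have "awalk (side_letter Q (f ?e)) [link_arc ?e] (side_letter Q (f (rotation C ?e)))"
      using tail_link_arc[OF e] head_link_arc[OF e] link_arc_in[OF e]
      by (metis arc_implies_awalk)
    note awalk_appendI[OF Suc this]
    moreover have "link_walk d (Suc n) = link_walk d n @ [link_arc ?e]"
      by (simp add: link_walk_def)
    moreover have "(rotation C ^^ Suc n) d = rotation C ?e" by simp
    ultimately show ?case by (simp only:)
  qed
qed

section \<open>Curvature of a spherical diagram\<close>

text \<open>A 2-cell covers the boundary of its image exactly once, so its own corners and edges
  have the same total weight and the same number as those of the relator.\<close>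

lemma face_weight:
  assumes weights: "\<forall>j < length (rels Q).
      (\<Sum>k < length (rels Q ! j). \<omega> (j, k)) \<le> real (length (rels Q ! j)) - 2"
    and F: "F \<in> cs_faces C"
  shows "(\<Sum>d \<in> F. \<omega> (fst (side_turn Q (f d)))) \<le> real (card F) - 2"
proof -
  obtain d where d: "d \<in> darts C" and Fd: "F = orbit (face_next C) d"
    using F unfolding cs_faces_def by auto
  obtain j k \<epsilon> where s: "f d = (j, k, \<epsilon>)" by (cases "f d")
  have jk: "j < length (rels Q)" "k < length (rels Q ! j)"
    using side_in[OF d] s by (auto simp: sides_def)
  have perm: "face_next C permutes darts C"
    using surface unfolding closed_surface_def by simp
  have inj: "inj_on f F"
    using diagram F unfolding spherical_diagram_def by simp
  have "f ` F = orbit (side_next Q) (f d)"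
    unfolding Fd
  proof (rule orbit_inverse)
    show "d \<in> orbit (face_next C) d"
      using perm finite_darts by (auto intro!: permutation_self_in_orbit simp: permutation_permutes)
    show "side_next Q (f x) = f (face_next C x)" if "x \<in> orbit (face_next C) d" for x
      using permutes_orbit_subset[OF perm d] that diagram unfolding spherical_diagram_def by auto
  qed
  then have image: "f ` F = (\<lambda>i. (j, i, \<epsilon>)) ` {..<length (rels Q ! j)}"
    using orbit_side_next[OF jk] s by simp
  have inj': "inj_on (\<lambda>i. (j, i, \<epsilon>)) {..<length (rels Q ! j)}" by (auto intro: inj_onI)
  have "card F = length (rels Q ! j)"
    using card_image[OF inj] card_image[OF inj'] image by simp
  moreover have "(\<Sum>d \<in> F. \<omega> (fst (side_turn Q (f d)))) = (\<Sum>s \<in> f ` F. \<omega> (fst (side_turn Q s)))"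
    using sum.reindex[OF inj, of "\<lambda>s. \<omega> (fst (side_turn Q s))"] by simp
  moreover have "\<dots> = (\<Sum>k < length (rels Q ! j). \<omega> (j, k))"
    unfolding image sum.reindex[OF inj'] using sum_turns_relator[of \<omega> Q j \<epsilon>] by (simp add: o_def)
  ultimately show ?thesis using weights jk by simp
qed

text \<open>Each corner belongs to one vertex and to one 2-cell. It is indexed by a dart at the vertex and by
  the reverse of that dart in the 2-cell.\<close>

lemma total_weight:
  "(\<Sum>V \<in> cs_vertices C. \<Sum>d \<in> V. \<omega> (fst (link_arc d))) =
   (\<Sum>F \<in> cs_faces C. \<Sum>d \<in> F. \<omega> (fst (side_turn Q (f d))))" for \<omega> :: "corner \<Rightarrow> real"
proof -
  have perm: "dart_rev C permutes darts C" "face_next C permutes darts C"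
    using surface unfolding closed_surface_def by auto
  have "(\<Sum>V \<in> cs_vertices C. \<Sum>d \<in> V. \<omega> (fst (link_arc d))) = (\<Sum>d \<in> darts C. \<omega> (fst (link_arc d)))"
    unfolding cs_vertices_def by (rule sum_over_orbits[OF finite_darts rotation_permutes[OF surface]])
  also have "\<dots> = (\<Sum>d \<in> darts C. \<omega> (fst (side_turn Q (f d))))"
    unfolding link_arc_def
    using sum.permute[OF perm(1), of "\<lambda>d. \<omega> (fst (side_turn Q (f d)))"] by (simp add: o_def)
  also have "\<dots> = (\<Sum>F \<in> cs_faces C. \<Sum>d \<in> F. \<omega> (fst (side_turn Q (f d))))"
    unfolding cs_faces_def by (rule sum_over_orbits[OF finite_darts perm(2), symmetric])
  finally show ?thesis .
qed

lemma card_darts_edges: "card (darts C) = 2 * card (cs_edges C)"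
proof -
  have perm: "dart_rev C permutes darts C"
    using surface unfolding closed_surface_def by simp
  have "card E = 2" if "E \<in> cs_edges C" for E
  proof -
    obtain d where d: "d \<in> darts C" and E: "E = orbit (dart_rev C) d"
      using \<open>E \<in> cs_edges C\<close> unfolding cs_edges_def by auto
    have rev: "dart_rev C d \<noteq> d" "dart_rev C (dart_rev C d) = d"
      using d surface unfolding closed_surface_def by auto
    have "(dart_rev C ^^ 2) d = d" using rev by (simp add: numeral_2_eq_2)
    then have "E = {(dart_rev C ^^ m) d | m. m < 2}"
      unfolding E by (rule orbit_altdef_bounded) simp
    also have "\<dots> = {d, dart_rev C d}"
      by (auto simp: setcompr_eq_image less_2_cases_iff Collect_disj_eq)
    finally show ?thesis using rev(1) by simp
  qed
  then have "(\<Sum>E \<in> cs_edges C. \<Sum>d \<in> E. 1 :: nat) = 2 * card (cs_edges C)" by simp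
  then show ?thesis
    using sum_over_orbits[OF finite_darts perm, of "\<lambda>_. 1 :: nat"] by (simp add: cs_edges_def)
qed

lemma sum_card_faces: "(\<Sum>F \<in> cs_faces C. card F) = card (darts C)"
proof -
  have "face_next C permutes darts C"
    using surface unfolding closed_surface_def by simp
  from sum_over_orbits[OF finite_darts this, of "\<lambda>_. 1 :: nat"]
  show ?thesis by (simp add: cs_faces_def)
qed

text \<open>If all vertices had weight at least \<open>2\<close>, comparing the corners by vertices and by 2-cells
  would give \<open>2 V \<le> 2 E - 2 F\<close>, contrary to \<open>V - E + F = 2\<close>.\<close>

lemma exists_light_vertex:
  fixes \<omega> :: "corner \<Rightarrow> real"
  assumes "\<forall>j < length (rels Q).
      (\<Sum>k < length (rels Q ! j). \<omega> (j, k)) \<le> real (length (rels Q ! j)) - 2"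
  shows "\<exists>V \<in> cs_vertices C. (\<Sum>d \<in> V. \<omega> (fst (link_arc d))) < 2"
proof (rule ccontr)
  assume "\<not> ?thesis"
  then have "(\<Sum>V \<in> cs_vertices C. 2) \<le> (\<Sum>V \<in> cs_vertices C. \<Sum>d \<in> V. \<omega> (fst (link_arc d)))"
    by (intro sum_mono) (auto simp: not_less)
  also have "\<dots> \<le> (\<Sum>F \<in> cs_faces C. real (card F) - 2)"
    unfolding total_weight by (intro sum_mono face_weight[OF assms])
  also have "\<dots> = 2 * real (card (cs_edges C)) - 2 * real (card (cs_faces C))"
    using sum_card_faces card_darts_edges
    by (simp add: sum_subtractf flip: of_nat_sum)
  finally have "card (cs_vertices C) + card (cs_faces C) \<le> card (cs_edges C)"
    by simp
  moreover have "int (card (cs_vertices C)) - int (card (cs_edges C)) + int (card (cs_faces C)) = 2"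
    using diagram unfolding spherical_diagram_def sphere_structure_def by simp
  ultimately show False by simp
qed

section \<open>Lower bounds for the weight of a vertex\<close>

text \<open>Distribute the weight of the corners: an edge end with label in \<open>S\<close> receives \<open>1/2\<close>
  from each of the two corners next to it, and the bounds on the weights are exactly what the corners
  need for this. Two such edge ends thus account for weight \<open>2\<close>.\<close>

lemma vertex_weight_two_labels_in:
  fixes \<omega> :: "corner \<Rightarrow> real"
  assumes nonneg: "\<forall>c \<in> corners Q. \<omega> c \<ge> 0"
    and both: "\<forall>c \<in> corners Q.
      fst (corner_source Q c) \<in> S \<and> fst (corner_target Q c) \<in> S \<longrightarrow> \<omega> c \<ge> 1"
    and one: "\<forall>c \<in> corners Q.
      (fst (corner_source Q c) \<in> S) \<noteq> (fst (corner_target Q c) \<in> S) \<longrightarrow> \<omega> c \<ge> 1 / 2"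
    and V: "V \<in> cs_vertices C"
    and d: "d \<in> V" "edge_label Q f d \<in> S" and e: "e \<in> V" "edge_label Q f e \<in> S"
    and "d \<noteq> e"
  shows "(\<Sum>d \<in> V. \<omega> (fst (link_arc d))) \<ge> 2"
proof -
  let ?rot = "rotation C"
  define h :: "'d \<Rightarrow> real" where "h d = (if edge_label Q f d \<in> S then 1 / 2 else 0)" for d
  note perm = rotation_permutes[OF surface]
  obtain v where v: "v \<in> darts C" "V = orbit ?rot v"
    using V unfolding cs_vertices_def by auto
  have VD: "V \<subseteq> darts C" using permutes_orbit_subset[OF perm] v by simp
  then have "finite V" using finite_darts finite_subset by blast
  have corner: "h x + h (?rot x) \<le> \<omega> (fst (link_arc x))" if "x \<in> V" for x
  proof -
    have x: "x \<in> darts C" using VD that by auto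
    obtain c b where cb: "link_arc x = (c, b)" by (cases "link_arc x")
    have c: "c \<in> corners Q" using link_arc_in[OF x] cb by (simp add: whitehead_graph_def)
    show ?thesis
      using tail_link_arc[OF x] head_link_arc[OF x] nonneg both one c cb
      by (cases b) (auto simp: whitehead_graph_def h_def edge_label_def)
  qed
  have "2 \<le> 2 * (\<Sum>x \<in> {d, e}. h x)" using d e \<open>d \<noteq> e\<close> by (simp add: h_def)
  also have "\<dots> \<le> 2 * (\<Sum>x \<in> V. h x)"
    using \<open>finite V\<close> d e by (intro mult_left_mono sum_mono2) (auto simp: h_def)
  also have "\<dots> = (\<Sum>x \<in> V. h x + h (?rot x))"
    using sum_orbit_shift[OF finite_darts perm, of h v] v by (simp add: sum.distrib)
  also have "\<dots> \<le> (\<Sum>x \<in> V. \<omega> (fst (link_arc x)))"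
    by (intro sum_mono corner)
  finally show ?thesis .
qed

text \<open>With the link based at \<open>d\<close>, a backtrack at an inner vertex of the walk would be a folding
  edge other than \<open>d\<close>.\<close>

lemma vertex_weight_fold_at_most_once:
  fixes \<omega> :: "corner \<Rightarrow> real"
  assumes "is_presentation Q" and nonneg: "\<forall>c \<in> corners Q. \<omega> c \<ge> 0"
    and cycles: "\<forall>z. reduced_cycle Q z \<longrightarrow> path_weight \<omega> z \<ge> 2"
    and V: "V \<in> cs_vertices C" and "d \<in> V"
    and unfolded: "\<And>e. e \<in> V \<Longrightarrow> e \<noteq> d \<Longrightarrow> \<not> folding_edge C f e"
  shows "(\<Sum>d \<in> V. \<omega> (fst (link_arc d))) \<ge> 2"
proof -
  let ?rot = "rotation C"
  note perm = rotation_permutes[OF surface]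
  have cyc: "cyclic_on ?rot V"
    using V cyclic_on_orbit[OF perm finite_darts] unfolding cs_vertices_def by auto
  then have Vd: "V = orbit ?rot d" using \<open>d \<in> V\<close> orbit_cyclic_eq3 by metis
  have "V \<subseteq> darts C"
    using V permutes_orbit_subset[OF perm] unfolding cs_vertices_def by auto
  then have dD: "d \<in> darts C" using \<open>d \<in> V\<close> by auto
  have self: "d \<in> orbit ?rot d" using \<open>d \<in> V\<close> Vd by simp
  \<comment> \<open>The period of \<open>d\<close>, so that the walk runs once around the vertex and returns to \<open>d\<close> only at its end.\<close>
  define n where "n = funpow_dist1 ?rot d d"
  have "n > 0" unfolding n_def by simp
  have closed: "(?rot ^^ n) d = d" unfolding n_def by (rule funpow_dist1_prop[OF self])
  have first: "(?rot ^^ i) d \<noteq> d" if "0 < i" "i < n" for i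
    using that funpow_dist1_least unfolding n_def by metis
  have "pre_digraph.awalk (whitehead_graph Q) (side_letter Q (f d)) (link_walk d n) (side_letter Q (f d))"
    using awalk_link_walk[OF assms(1) dD, of n] closed by simp
  moreover have "link_walk d n \<noteq> []" using \<open>n > 0\<close> by (simp add: link_walk_def)
  moreover have "link_walk d n ! Suc i \<noteq> rev_arc (link_walk d n ! i)"
    if "Suc i < length (link_walk d n)" for i
  proof
    assume backtrack: "link_walk d n ! Suc i = rev_arc (link_walk d n ! i)"
    have i: "Suc i < n" using that by (simp add: link_walk_def)
    have "folding_edge C f ((?rot ^^ Suc i) d)"
      using link_backtrack_folding[OF rotation_funpow_in[OF dD, of i]] backtrack i
      by (simp add: link_walk_def)
    moreover have "(?rot ^^ Suc i) d \<in> V"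
      using cyc \<open>d \<in> V\<close> by (rule cyclic_on_funpow_in)
    ultimately show False using unfolded first[of "Suc i"] i by blast
  qed
  ultimately have "2 \<le> path_weight \<omega> (link_walk d n)"
    by (rule closed_walk_weight[OF assms(1) nonneg cycles])
  also have "\<dots> = (\<Sum>i \<in> {0..<n}. \<omega> (fst (link_arc ((?rot ^^ i) d))))"
    by (simp add: path_weight_def link_walk_def o_def interv_sum_list_conv_sum_set_nat)
  also have "\<dots> = (\<Sum>d \<in> V. \<omega> (fst (link_arc d)))"
    unfolding Vd orbit_conv_funpow_dist1[OF self] n_def
    using sum.reindex[OF inj_on_funpow_dist1[OF self], of "\<lambda>d. \<omega> (fst (link_arc d))"]
    by (simp add: o_def)
  finally show ?thesis .
qed

end

section \<open>Diagrammatic reducibility\<close>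

theorem theorem5p4:
  fixes Q :: "'g presentation" and ys xs :: "'g list" and \<omega> :: "corner \<Rightarrow> real"
  assumes "is_presentation Q" and "gens Q = ys @ xs"
    and "\<forall>r \<in> set (rels Q). cyclically_reduced r"
    and nonneg: "\<forall>c \<in> corners Q. \<omega> c \<ge> 0"
    and cond1: "\<forall>c \<in> corners Q.
      fst (corner_source Q c) \<in> set ys \<and> fst (corner_target Q c) \<in> set ys \<longrightarrow> \<omega> c \<ge> 1"
    and cond2: "\<forall>c \<in> corners Q.
      (fst (corner_source Q c) \<in> set ys) \<noteq> (fst (corner_target Q c) \<in> set ys) \<longrightarrow> \<omega> c \<ge> 1 / 2"
    and cond3: "\<forall>z. reduced_cycle Q z \<longrightarrow> path_weight \<omega> z \<ge> 2"
    and cond4: "\<forall>j < length (rels Q).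
      (\<Sum>k < length (rels Q ! j). \<omega> (j, k)) \<le> real (length (rels Q ! j)) - 2"
  shows "DR_directed_away Q (set ys)"
proof (unfold DR_directed_away_def, intro allI impI, rule ccontr)
  fix C :: "nat cell_structure" and f
  assume diagram: "spherical_diagram Q C f"
    and no_fold: "\<not> (\<exists>d \<in> darts C. edge_label Q f d \<notin> set ys \<and> folding_edge C f d)"
  obtain V where V: "V \<in> cs_vertices C"
    and light: "(\<Sum>d \<in> V. \<omega> (fst (link_arc Q C f d))) < 2"
    using exists_light_vertex[OF diagram cond4] by blast
  have VD: "V \<subseteq> darts C"
    using V permutes_orbit_subset[OF rotation_permutes[OF surface[OF diagram]]]
    unfolding cs_vertices_def by auto
  have "V \<noteq> {}"
    using V unfolding cs_vertices_def by (auto simp del: comp_apply simp: orbit_nonempty)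
  \<comment> \<open>If no edge at \<open>V\<close> has a label in \<open>ys\<close>, every \<open>d\<close> will do.\<close>
  have "\<exists>d \<in> V. \<forall>e \<in> V. e \<noteq> d \<longrightarrow> edge_label Q f e \<notin> set ys"
    using vertex_weight_two_labels_in[OF diagram nonneg cond1 cond2 V] light \<open>V \<noteq> {}\<close>
    by (meson all_not_in_conv not_less)
  then obtain d where "d \<in> V" and "\<And>e. e \<in> V \<Longrightarrow> e \<noteq> d \<Longrightarrow> \<not> folding_edge C f e"
    using no_fold VD by blast
  then have "(\<Sum>d \<in> V. \<omega> (fst (link_arc Q C f d))) \<ge> 2"
    by (intro vertex_weight_fold_at_most_once[OF diagram assms(1) nonneg cond3 V])
  then show False using light by simp
qed

end
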